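(* Let $s_1,\dots,s_n\in\mathcal{S}$, let $x_j(t)=x(t,s_j)$ be the corresponding solutions of the parameterized dynamical system $x'=f(x,t,s)$, $x(0)=x_0$, and let $\tilde{x}(t,s)=\sum_{j=1}^n a_j(s)x_j(t)$ be the residual minimizing approximation, where $a(s)=(a_1(s),\dots,a_n(s))^T$ is a minimizer of $\rho(a,s)$ over $a\in\mathbb{R}^n$ subject to $e^Ta=1$. Then the residual minimizing approximation $\tilde{x}(t,s)$ interpolates the basis elements, i.e., $$\tilde{x}(t_i,s_j)=x_j(t_i),\qquad i=1,\dots,m,\quad j=1,\dots,n.$$
   Context: Setting. $\mathcal{S}\subset\mathbb{R}^d$ is the parameter space, $T>0$, and for each $s\in\mathcal{S}$, $x(t,s)\in\mathbb{R}^p$ is the solution on $[0,T]$ of $x'=f(x,t,s)$ (prime denotes $d/dt$) with initial condition $x(0)=x_0$ independent of $s$. The solution is assumed bounded for all $t\in[0,T]$, $s\in\mathcal{S}$; $f$ is $\mathbb{R}^p$-valued, Lipschitz continuous, and its Jacobian $\nabla_x f$ with respect to the states is nonsingular. Fix times $0\le t_1<\cdots<t_m\le T$, with $w_i^2$ the integration weight associated with time $t_i$. Given $s_1,\dots,s_n\in\mathcal{S}$, the functions $x_j(t)=x(t,s_j)$ are called the bases (basis elements). $X_i\in\mathbb{R}^{p\times n}$ is the matrix whose $j$th column is $x_j(t_i)$, so that $\tilde{x}(t_i,s)=X_ia(s)$, and $F_i\in\mathbb{R}^{p\times n}$ is the matrix whose $j$th column is $f(x_j(t_i),t_i,s_j)$.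 $e\in\mathbb{R}^n$ is the vector of ones and $\|\cdot\|$ is the Euclidean norm. For $s\in\mathcal{S}$ and $a\in\mathbb{R}^n$, $$\rho(a,s)=\sum_{i=1}^m w_i^2\,\|F_ia-f(X_ia,t_i,s)\|^2 .$$
   Formalization: The formal theorem also assumes that at each basis parameter s_j all constrained minimizers of ρ give the same approximate states X_i a; without this the claim can fail, e.g. f=(1-t)s-x, x_0=0, m=1, t_1=1, where ρ vanishes identically. *)

theory Defs
  imports "HOL-Analysis.Analysis"
begin

text \<open>
  Throughout, \<open>x \<tau> s\<close> is the state at time \<open>\<tau>\<close> for the parameter \<open>s\<close>, \<open>f z \<tau> s\<close> is the
  right-hand side of the system, and \<open>\<sigma> j\<close> (\<open>j :: 'n\<close>) are the basis parameters, so that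
  the basis elements are \<open>\<lambda>\<tau>. x \<tau> (\<sigma> j)\<close>.
\<close>

definition param_ode_solution ::
  "(real^'p \<Rightarrow> real \<Rightarrow> real^'d \<Rightarrow> real^'p) \<Rightarrow> real \<Rightarrow> (real^'d) set \<Rightarrow> real^'p
    \<Rightarrow> (real \<Rightarrow> real^'d \<Rightarrow> real^'p) \<Rightarrow> bool" where
  "param_ode_solution f T S x0 x \<longleftrightarrow>
    (\<forall>s\<in>S. x 0 s = x0 \<and>
      (\<forall>\<tau>\<in>{0..T}.
        ((\<lambda>r. x r s) has_vector_derivative f (x \<tau> s) \<tau> s) (at \<tau> within {0..T})))"

text \<open>
  Lipschitz continuity is required in the state only, uniformly in time and for each
  parameter separately; it follows from Lipschitz continuity in all arguments jointly.
\<close>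

definition lipschitz_in_state ::
  "(real^'p \<Rightarrow> real \<Rightarrow> real^'d \<Rightarrow> real^'p) \<Rightarrow> real \<Rightarrow> (real^'d) set \<Rightarrow> bool" where
  "lipschitz_in_state f T S \<longleftrightarrow>
    (\<forall>s\<in>S. \<exists>L. \<forall>\<tau>\<in>{0..T}. L-lipschitz_on UNIV (\<lambda>z. f z \<tau> s))"

definition nonsingular_state_jacobian ::
  "(real^'p \<Rightarrow> real \<Rightarrow> real^'d \<Rightarrow> real^'p) \<Rightarrow> real \<Rightarrow> (real^'d) set \<Rightarrow> bool" where
  "nonsingular_state_jacobian f T S \<longleftrightarrow>
    (\<forall>s\<in>S. \<forall>\<tau>\<in>{0..T}. \<forall>z.
      (\<lambda>y. f y \<tau> s) differentiable (at z) \<and> invertible (jacobian (\<lambda>y. f y \<tau> s) (at z)))"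

text \<open>
  The \<open>p \<times> n\<close> matrices \<open>X\<^sub>i\<close> and \<open>F\<^sub>i\<close> are the values at \<open>\<tau> = t\<^sub>i\<close> of the following two
  matrix functions of time.
\<close>

definition basis_matrix ::
  "(real \<Rightarrow> real^'d \<Rightarrow> real^'p) \<Rightarrow> ('n::finite \<Rightarrow> real^'d) \<Rightarrow> real \<Rightarrow> real^'n^'p" where
  "basis_matrix x \<sigma> \<tau> = (\<chi> k j. x \<tau> (\<sigma> j) $ k)"

definition rhs_matrix ::
  "(real^'p \<Rightarrow> real \<Rightarrow> real^'d \<Rightarrow> real^'p) \<Rightarrow> (real \<Rightarrow> real^'d \<Rightarrow> real^'p)
    \<Rightarrow> ('n::finite \<Rightarrow> real^'d) \<Rightarrow> real \<Rightarrow> real^'n^'p" where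
  "rhs_matrix f x \<sigma> \<tau> = (\<chi> k j. f (x \<tau> (\<sigma> j)) \<tau> (\<sigma> j) $ k)"

definition residual ::
  "(real^'p \<Rightarrow> real \<Rightarrow> real^'d \<Rightarrow> real^'p) \<Rightarrow> (real \<Rightarrow> real^'d \<Rightarrow> real^'p)
    \<Rightarrow> ('n::finite \<Rightarrow> real^'d) \<Rightarrow> nat \<Rightarrow> (nat \<Rightarrow> real) \<Rightarrow> (nat \<Rightarrow> real)
    \<Rightarrow> real^'n \<Rightarrow> real^'d \<Rightarrow> real" where
  "residual f x \<sigma> m t w a s =
    (\<Sum>i=1..m. (w i)\<^sup>2 *
      (norm (rhs_matrix f x \<sigma> (t i) *v a - f (basis_matrix x \<sigma> (t i) *v a) (t i) s))\<^sup>2)"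

definition residual_minimizer ::
  "(real^'p \<Rightarrow> real \<Rightarrow> real^'d \<Rightarrow> real^'p) \<Rightarrow> (real \<Rightarrow> real^'d \<Rightarrow> real^'p)
    \<Rightarrow> ('n::finite \<Rightarrow> real^'d) \<Rightarrow> nat \<Rightarrow> (nat \<Rightarrow> real) \<Rightarrow> (nat \<Rightarrow> real)
    \<Rightarrow> real^'d \<Rightarrow> real^'n \<Rightarrow> bool" where
  "residual_minimizer f x \<sigma> m t w s a \<longleftrightarrow>
    is_arg_min (\<lambda>b. residual f x \<sigma> m t w b s) (\<lambda>b. (\<chi> j. 1) \<bullet> b = 1) a"

definition approximation ::
  "(real \<Rightarrow> real^'d \<Rightarrow> real^'p) \<Rightarrow> ('n::finite \<Rightarrow> real^'d) \<Rightarrow> (real^'d \<Rightarrow> real^'n)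
    \<Rightarrow> real \<Rightarrow> real^'d \<Rightarrow> real^'p" where
  "approximation x \<sigma> a \<tau> s = (\<Sum>j\<in>UNIV. (a s $ j) *\<^sub>R x \<tau> (\<sigma> j))"

text \<open>
  Constrained minimizers of the residual need not be unique.  Speaking of \<^emph>\<open>the\<close> residual
  minimizing approximation at a parameter \<open>s\<close> presupposes that all of them give the same
  approximate states \<open>X\<^sub>i a\<close>.  This is not automatic: for \<open>f z \<tau> s = (1 - \<tau>) s - z\<close>,
  \<open>m = 1\<close>, \<open>t\<^sub>1 = 1\<close> the residual vanishes for every \<open>a\<close> and \<open>s\<close>,
  while \<open>X\<^sub>1 a\<close> varies with \<open>a\<close> as soon as the basis parameters are distinct.
\<close>

definition approximation_well_defined_at ::
  "(real^'p \<Rightarrow> real \<Rightarrow> real^'d \<Rightarrow> real^'p) \<Rightarrow> (real \<Rightarrow> real^'d \<Rightarrow> real^'p)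
    \<Rightarrow> ('n::finite \<Rightarrow> real^'d) \<Rightarrow> nat \<Rightarrow> (nat \<Rightarrow> real) \<Rightarrow> (nat \<Rightarrow> real)
    \<Rightarrow> real^'d \<Rightarrow> bool" where
  "approximation_well_defined_at f x \<sigma> m t w s \<longleftrightarrow>
    (\<forall>b c. residual_minimizer f x \<sigma> m t w s b \<longrightarrow> residual_minimizer f x \<sigma> m t w s c \<longrightarrow>
      (\<forall>i\<in>{1..m}. basis_matrix x \<sigma> (t i) *v b = basis_matrix x \<sigma> (t i) *v c))"

end

theory Submission
  imports Defs
begin

text \<open>
  At a basis parameter \<open>\<sigma> j\<close> the unit vector \<open>e\<^sub>j\<close> satisfies the constraint and reproduces
  \<open>x\<^sub>j\<close>, so its residual vanishes. Since the residual is nonnegative, \<open>e\<^sub>j\<close> is a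
  minimizer, and every minimizer gives the same approximate states as \<open>e\<^sub>j\<close>.
\<close>

text \<open>Bridges the conclusion, a sum of basis elements, and the products
  \<open>X\<^sub>i a\<close> in which the residual and well-definedness are phrased.\<close>

lemma approximation_eq_matrix_vector_mult:
  "approximation x \<sigma> a \<tau> s = basis_matrix x \<sigma> \<tau> *v a s"
  by (simp add: approximation_def basis_matrix_def vec_eq_iff matrix_vector_mult_def mult.commute)

lemma basis_matrix_axis: "basis_matrix x \<sigma> \<tau> *v axis j 1 = x \<tau> (\<sigma> j)"
  by (simp add: matrix_vector_mult_basis column_def basis_matrix_def vec_eq_iff)

lemma rhs_matrix_axis: "rhs_matrix f x \<sigma> \<tau> *v axis j 1 = f (x \<tau> (\<sigma> j)) \<tau> (\<sigma> j)"
  by (simp add: matrix_vector_mult_basis column_def rhs_matrix_def vec_eq_iff)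

lemma residual_nonneg: "0 \<le> residual f x \<sigma> m t w a s"
  by (simp add: residual_def sum_nonneg)

text \<open>Column \<open>j\<close> of \<open>F\<^sub>i\<close> is evaluated at the parameter
  \<open>\<sigma> j\<close>, the very one at which the residual is taken, so the two terms in each
  norm cancel.\<close>

lemma residual_axis: "residual f x \<sigma> m t w (axis j 1) (\<sigma> j) = 0"
  by (simp add: residual_def basis_matrix_axis rhs_matrix_axis)

lemma residual_minimizer_axis: "residual_minimizer f x \<sigma> m t w (\<sigma> j) (axis j 1)"
  by (simp add: residual_minimizer_def is_arg_min_def residual_axis residual_nonneg not_less
      inner_axis)

theorem theorem4p2:
  fixes f :: "real^'p \<Rightarrow> real \<Rightarrow> real^'d \<Rightarrow> real^'p"
    and S :: "(real^'d) set"
    and T :: real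
    and x0 :: "real^'p"
    and x :: "real \<Rightarrow> real^'d \<Rightarrow> real^'p"
    and m :: nat
    and t w :: "nat \<Rightarrow> real"
    and \<sigma> :: "'n::finite \<Rightarrow> real^'d"
    and a :: "real^'d \<Rightarrow> real^'n"
  assumes "T > 0"
    and "param_ode_solution f T S x0 x"
    and "bounded ((\<lambda>(\<tau>, s). x \<tau> s) ` ({0..T} \<times> S))"
    and "lipschitz_in_state f T S"
    and "nonsingular_state_jacobian f T S"
    and "strict_mono_on {1..m} t"
    and "\<And>i. i \<in> {1..m} \<Longrightarrow> t i \<in> {0..T}"
    and "\<And>j. \<sigma> j \<in> S"
    and "\<And>s. s \<in> S \<Longrightarrow> residual_minimizer f x \<sigma> m t w s (a s)"
    and "\<And>j. approximation_well_defined_at f x \<sigma> m t w (\<sigma> j)"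
  shows "\<forall>i\<in>{1..m}. \<forall>j. approximation x \<sigma> a (t i) (\<sigma> j) = x (t i) (\<sigma> j)"
proof (intro ballI allI)
  fix i j
  assume "i \<in> {1..m}"
  \<comment> \<open>Well-definedness at \<open>\<sigma> j\<close> compares the two minimizers
    \<open>a (\<sigma> j)\<close> and \<open>axis j 1\<close>. Only their states are identified: the
    coefficients may differ, for instance when two basis parameters coincide.\<close>
  with assms(8-10) have "basis_matrix x \<sigma> (t i) *v a (\<sigma> j) = basis_matrix x \<sigma> (t i) *v axis j 1"
    unfolding approximation_well_defined_at_def using residual_minimizer_axis by blast
  then show "approximation x \<sigma> a (t i) (\<sigma> j) = x (t i) (\<sigma> j)"
    by (simp add: approximation_eq_matrix_vector_mult basis_matrix_axis)
qed

end
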